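(* Let $a,b\in\mathbb{N}$ with $b$ even and $b\le 2a$. Then there exists $\varepsilon\in(0,1)$ such that for every $\alpha\in C^\infty((-1,1),[0,1])$ the following holds: in the sub-Riemannian manifold $(M,\mathcal{D},g)$ determined by $a$, $b$ and $\alpha$, the curve $\gamma|_{[-\varepsilon,\varepsilon]}$ is a geodesic, where $\gamma:(-1,1)\to M$, $\gamma(t):=(0,t,0)$.
   Context: Notation: $\mathbb{N}=\{1,2,3,\dots\}$. Let $M:=(-\tfrac12,\tfrac12)\times(-1,1)\times\mathbb{R}\subset\mathbb{R}^3$ with coordinates $x=(x_1,x_2,x_3)$. For $b\in\mathbb{N}$ define the vector fields on $M$ $$X_1(x):=\partial_1,\qquad X_2(x):=\partial_2+x_1^2x_2^b\,\partial_3,$$ and the distribution $\mathcal{D}:=\mathrm{span}\{X_1,X_2\}$. For $a\in\mathbb{N}$ and $\alpha\in C^\infty((-1,1),[0,1])$ let $g$ be the Riemannian metric on $\mathcal{D}$ given by $$g_x(X_1,X_1)=1,\quad g_x(X_1,X_2)=0,\quad g_x(X_2,X_2)=1-\alpha(x_2)\,x_1x_2^a,\qquad x\in M.$$ An absolutely continuous curve $\eta:I\to M$ on an interval $I$ is horizontal if $\dot\eta(t)\in\mathcal{D}_{\eta(t)}$ for almost every $t\in I$. Its length, for $\eta:[0,1]\to M$, is $L(\eta):=\int_0^1 g_{\eta(t)}(\dot\eta(t),\dot\eta(t))^{1/2}\,dt$. The sub-Riemannian distance on $M$ is $d(x,y):=\inf\{L(\eta)\mid \eta:[0,1]\to M\text{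 horizontal},\ \eta(0)=x,\ \eta(1)=y\}$. A curve $\eta:I\to M$ is a geodesic if it is an isometric embedding of the interval $I$ into $(M,d)$, i.e. $d(\eta(s),\eta(t))=|s-t|$ for all $s,t\in I$. *)

theory Defs
  imports "HOL-Analysis.Analysis"
begin

subsection \<open>Sub-Riemannian structures on subsets of Euclidean space\<close>

text \<open>
  A sub-Riemannian structure on a set \<open>M\<close> is given by \<open>D\<close>, the fibres \<open>D x\<close> of the
  distribution, and \<open>g\<close>, the forms \<open>g x\<close>; only the values of \<open>g x\<close> on \<open>D x\<close>
  for \<open>x\<close> in \<open>M\<close> are relevant.
\<close>

text \<open>
  Absolute continuity of curves, in the usual epsilon-delta form: a \<open>d\<close> with
  \<open>d division_of \<Union>d\<close> is a finite family of compact intervals \<open>k = {Inf k..Sup k}\<close> with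
  pairwise disjoint interiors. The library constant \<open>absolutely_continuous\<close> is a relation
  between measures.
\<close>

definition abs_continuous_on :: "real set \<Rightarrow> (real \<Rightarrow> 'a::real_normed_vector) \<Rightarrow> bool" where
  "abs_continuous_on I f \<longleftrightarrow>
     (\<forall>\<epsilon>>0. \<exists>\<delta>>0. \<forall>d. d division_of \<Union>d \<and> \<Union>d \<subseteq> I \<and> (\<Sum>k\<in>d. Sup k - Inf k) < \<delta> \<longrightarrow>
        (\<Sum>k\<in>d. norm (f (Sup k) - f (Inf k))) < \<epsilon>)"

definition horizontal ::
  "'a::euclidean_space set \<Rightarrow> ('a \<Rightarrow> 'a set) \<Rightarrow> real set \<Rightarrow> (real \<Rightarrow> 'a) \<Rightarrow> bool" where
  "horizontal M D I \<eta> \<longleftrightarrow>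
     is_interval I \<and> \<eta> ` I \<subseteq> M \<and> abs_continuous_on I \<eta> \<and>
     (AE t in lebesgue. t \<in> I \<longrightarrow>
        (\<exists>v. (\<eta> has_vector_derivative v) (at t within I) \<and> v \<in> D (\<eta> t)))"

definition curve_length ::
  "('a::euclidean_space \<Rightarrow> 'a \<Rightarrow> 'a \<Rightarrow> real) \<Rightarrow> (real \<Rightarrow> 'a) \<Rightarrow> ennreal" where
  "curve_length g \<eta> =
     (\<integral>\<^sup>+t\<in>{0..1}. ennreal (sqrt (g (\<eta> t) (vector_derivative \<eta> (at t within {0..1}))
                                       (vector_derivative \<eta> (at t within {0..1})))) \<partial>lebesgue)"

text \<open>The infimum is taken in \<open>[0,\<infinity>]\<close>, so the distance is infinite if no curve exists.\<close>

definition sr_dist ::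
  "'a::euclidean_space set \<Rightarrow> ('a \<Rightarrow> 'a set) \<Rightarrow> ('a \<Rightarrow> 'a \<Rightarrow> 'a \<Rightarrow> real) \<Rightarrow> 'a \<Rightarrow> 'a \<Rightarrow> ennreal" where
  "sr_dist M D g x y =
     Inf {curve_length g \<eta> | \<eta>. horizontal M D {0..1} \<eta> \<and> \<eta> 0 = x \<and> \<eta> 1 = y}"

definition geodesic_on ::
  "'a::euclidean_space set \<Rightarrow> ('a \<Rightarrow> 'a set) \<Rightarrow> ('a \<Rightarrow> 'a \<Rightarrow> 'a \<Rightarrow> real) \<Rightarrow> real set \<Rightarrow>
     (real \<Rightarrow> 'a) \<Rightarrow> bool" where
  "geodesic_on M D g I \<eta> \<longleftrightarrow>
     is_interval I \<and> \<eta> ` I \<subseteq> M \<and>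
     (\<forall>s\<in>I. \<forall>t\<in>I. sr_dist M D g (\<eta> s) (\<eta> t) = ennreal \<bar>s - t\<bar>)"

subsection \<open>The structure determined by \<open>a\<close>, \<open>b\<close> and \<open>\<alpha>\<close>\<close>

text \<open>
  Meaningful for open \<open>S\<close>, where \<open>deriv\<close> and its iterates at points of \<open>S\<close> depend only
  on the restriction of the function to \<open>S\<close>.
\<close>

definition smooth_on :: "real set \<Rightarrow> (real \<Rightarrow> real) \<Rightarrow> bool" where
  "smooth_on S f \<longleftrightarrow> (\<forall>n. (deriv ^^ n) f differentiable_on S)"

definition M_space :: "(real^3) set" where
  "M_space = {x. -1/2 < x$1 \<and> x$1 < 1/2 \<and> -1 < x$2 \<and> x$2 < 1}"

definition X1 :: "real^3 \<Rightarrow> real^3" where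
  "X1 x = vector [1, 0, 0]"

definition X2 :: "nat \<Rightarrow> real^3 \<Rightarrow> real^3" where
  "X2 b x = vector [0, 1, (x$1)^2 * (x$2)^b]"

definition sr_distr :: "nat \<Rightarrow> real^3 \<Rightarrow> (real^3) set" where
  "sr_distr b x = span {X1 x, X2 b x}"

text \<open>
  A vector \<open>v\<close> of the distribution at \<open>x\<close> equals \<open>v$1 *\<^sub>R X1 x + v$2 *\<^sub>R X2 b x\<close>, so \<open>v$1\<close> and
  \<open>v$2\<close> are its coordinates in the frame \<open>X1\<close>, \<open>X2\<close>. By \<open>sr_metric_frame\<close> and \<open>sr_metric_unique\<close>
  below, the following is the form on the distribution with the prescribed values on the frame.
\<close>

definition sr_metric :: "nat \<Rightarrow> (real \<Rightarrow> real) \<Rightarrow> real^3 \<Rightarrow> real^3 \<Rightarrow> real^3 \<Rightarrow> real" where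
  "sr_metric a \<alpha> x v w = v$1 * w$1 + (1 - \<alpha> (x$2) * x$1 * (x$2)^a) * (v$2 * w$2)"

definition \<gamma> :: "real \<Rightarrow> real^3" where
  "\<gamma> t = vector [0, t, 0]"

lemma sr_distr_frame_coords:
  assumes "v \<in> sr_distr b x"
  shows "v = v$1 *\<^sub>R X1 x + v$2 *\<^sub>R X2 b x"
proof -
  obtain p q where "v = p *\<^sub>R X1 x + q *\<^sub>R X2 b x"
    using assms by (auto simp: sr_distr_def span_insert span_singleton algebra_simps)
  then show ?thesis by (simp add: X1_def X2_def)
qed

lemma sr_metric_frame:
  "sr_metric a \<alpha> x (X1 x) (X1 x) = 1"
  "sr_metric a \<alpha> x (X1 x) (X2 b x) = 0"
  "sr_metric a \<alpha> x (X2 b x) (X2 b x) = 1 - \<alpha> (x$2) * x$1 * (x$2)^a"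
  by (simp_all add: sr_metric_def X1_def X2_def)

lemma sr_metric_bilinear: "bilinear (sr_metric a \<alpha> x)"
  by (auto simp: bilinear_def sr_metric_def intro!: linearI) (simp_all add: algebra_simps)

lemma sr_metric_sym: "sr_metric a \<alpha> x v w = sr_metric a \<alpha> x w v"
  by (simp add: sr_metric_def mult.commute)

lemma sr_metric_unique:
  assumes "bilinear h" "h (X1 x) (X1 x) = 1" "h (X1 x) (X2 b x) = 0" "h (X2 b x) (X1 x) = 0"
    and "h (X2 b x) (X2 b x) = 1 - \<alpha> (x$2) * x$1 * (x$2)^a"
    and "v \<in> sr_distr b x" "w \<in> sr_distr b x"
  shows "h v w = sr_metric a \<alpha> x v w"
proof -
  have "h v w = h (v$1 *\<^sub>R X1 x + v$2 *\<^sub>R X2 b x) (w$1 *\<^sub>R X1 x + w$2 *\<^sub>R X2 b x)"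
    using sr_distr_frame_coords assms(6,7) by metis
  also have "\<dots> = sr_metric a \<alpha> x v w"
    by (simp add: bilinear_ladd[OF assms(1)] bilinear_radd[OF assms(1)]
        bilinear_lmul[OF assms(1)] bilinear_rmul[OF assms(1)] assms(2-5) sr_metric_def)
  finally show ?thesis .
qed

lemma sr_metric_pos:
  assumes "x \<in> M_space" "\<alpha> ` {-1<..<1} \<subseteq> {0..1}" "v \<in> sr_distr b x" "v \<noteq> 0"
  shows "sr_metric a \<alpha> x v v > 0"
proof -
  have "\<alpha> (x$2) \<in> {0..1}" using assms(1,2) by (force simp: M_space_def)
  then have "\<bar>\<alpha> (x$2)\<bar> \<le> 1" by auto
  moreover have "\<bar>x$2\<bar>^a \<le> 1" using assms(1) by (intro power_le_one) (auto simp: M_space_def)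
  moreover have "\<bar>x$1\<bar> < 1" using assms(1) by (auto simp: M_space_def)
  ultimately have "\<bar>\<alpha> (x$2)\<bar> * \<bar>x$2\<bar>^a * \<bar>x$1\<bar> \<le> 1 * 1 * \<bar>x$1\<bar>"
    by (intro mult_mono) auto
  then have "\<bar>\<alpha> (x$2) * x$1 * (x$2)^a\<bar> < 1"
    using \<open>\<bar>x$1\<bar> < 1\<close> by (simp add: abs_mult power_abs mult_ac)
  then have c: "1 - \<alpha> (x$2) * x$1 * (x$2)^a > 0" by linarith
  have "v$1 \<noteq> 0 \<or> v$2 \<noteq> 0"
    using sr_distr_frame_coords[OF assms(3)] assms(4) by auto
  then show ?thesis
  proof
    assume "v$1 \<noteq> 0"
    then have "v$1 * v$1 > 0" by (metis mult_pos_pos mult_neg_neg linorder_neqE)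
    then show ?thesis unfolding sr_metric_def using c
      by (intro add_pos_nonneg) auto
  next
    assume "v$2 \<noteq> 0"
    then have "v$2 * v$2 > 0" by (metis mult_pos_pos mult_neg_neg linorder_neqE)
    then show ?thesis unfolding sr_metric_def using mult_pos_pos[OF c]
      by (intro add_nonneg_pos) auto
  qed
qed

end

theory Submission
  imports Defs
begin

text \<open>
  The segment of \<open>\<gamma>\<close> from \<open>\<gamma> s\<close> to \<open>\<gamma> t\<close> has length \<open>T = \<bar>s - t\<bar>\<close>, so the point is that no
  horizontal curve \<open>\<eta> = (x, y, z)\<close> with the same ends is shorter. A shorter curve must use
  \<open>x y^a > 0\<close>, where the metric is cheaper than the Euclidean one. Three effects compete:

  \<^item> moving along \<open>y\<close> saves at most \<open>\<bar>x\<bar> \<bar>y\<bar>^a \<bar>y'\<bar>\<close> per unit of time;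
  \<^item> reaching the maximal deviation \<open>X = max \<bar>x\<bar>\<close> and coming back costs \<open>\<integral> \<bar>x'\<bar> \<ge> 2 X\<close>;
  \<^item> the horizontality condition \<open>z' = x^2 y^b y'\<close> with \<open>z(0) = z(1) = 0\<close> gives
    \<open>\<integral> x^2 y^b y' = 0\<close>; as \<open>b\<close> is even, an advance of \<open>y\<close> away from the planes \<open>x = 0\<close>
    and \<open>y = 0\<close> has to be balanced by moving \<open>y\<close> backwards.

  The saving is split by the arithmetic-geometric mean inequality with weight \<open>X^2\<close>,
  \<open>\<bar>x y^a\<bar> \<le> X^2 / 2 + x^2 y^(2 a) / (2 X^2)\<close>,
  and the last term is at most \<open>x^2 y^b / (2 X^2)\<close> because \<open>b \<le> 2 a\<close> and \<open>\<bar>y\<bar> \<le> 1\<close>; this is a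
  multiple of the factor \<open>x^2 y^b\<close> in the constraint. The cost of the deviation enters through the Cauchy-Schwarz inequality
  \<open>sqrt (1 + X^2) * sqrt (p^2 + q^2) \<ge> X \<bar>p\<bar> + \<bar>q\<bar>\<close>. Together these bound the speed from below
  by an expression that is linear in the velocity (\<open>calibration_bound\<close>):
  \<open>sqrt (1 + X^2) * speed \<ge> \<plusminus>X x' \<plusminus> ((1 - X^2 / 2) y' - z' / (2 X^2))\<close>
  with free choice of both signs. For \<open>t > s\<close> the second sign is \<open>+\<close>; the first one is the sign
  of \<open>x(\<tau>)\<close> before a time \<open>\<tau>\<close> with \<open>\<bar>x(\<tau>)\<bar> = X\<close>, and the opposite sign after it. The integral of the right-hand side depends
  only on the ends and on \<open>X\<close>: it is \<open>2 X^2 + (1 - X^2 / 2) T\<close>. As \<open>T \<le> 2\<close>, this is at least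
  \<open>(1 + X^2 / 2) T \<ge> sqrt (1 + X^2) T\<close>, so the length is at least \<open>T\<close>
  (\<open>curve_length_lower_bound\<close>).

  Integrating the velocity uses the fundamental theorem of calculus for absolutely continuous
  curves (\<open>abs_continuous_on_has_integral\<close>).
\<close>

section \<open>Absolutely continuous curves\<close>

lemma abs_continuous_on_subset:
  assumes "abs_continuous_on T f" "S \<subseteq> T"
  shows "abs_continuous_on S f"
  using assms unfolding abs_continuous_on_def by (meson order_trans)

lemma negligible_open_superset_small:
  fixes N :: "'a::euclidean_space set"
  assumes "negligible N" "0 < e"
  obtains U where "open U" "N \<subseteq> U" "U \<in> lmeasurable" "measure lebesgue U < e"
proof -
  have N: "N \<in> null_sets lebesgue" using assms(1) by (simp add: negligible_iff_null_sets)
  then obtain U where U: "open U" "N \<subseteq> U" "emeasure lebesgue (U - N) < ennreal e"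
    using sets_lebesgue_outer_open[OF null_setsD2 assms(2)] by metis
  have "emeasure lebesgue U = emeasure lebesgue (U - N)"
    using N U(1) by (simp add: emeasure_Diff_null_set borel_open)
  with U(3) have "emeasure lebesgue U < ennreal e" by simp
  moreover from this have Um: "U \<in> lmeasurable"
    using U(1) by (intro fmeasurableI) (auto intro: order.strict_trans simp: borel_open less_top)
  ultimately have "measure lebesgue U < e"
    using assms(2) by (simp add: emeasure_eq_measure2 ennreal_less_iff)
  then show thesis
    using that U(1,2) Um by blast
qed

text \<open>
  The fundamental theorem of calculus for absolutely continuous curves, in terms of the gauge
  integral. Fix an open set \<open>U\<close> of small measure around the null set \<open>N\<close> where the curve fails to
  be differentiable, and a gauge that keeps the intervals tagged in \<open>N\<close> inside \<open>U\<close>. These intervals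
  have small total length, so by absolute continuity they contribute little to \<open>f b - f a\<close>; over
  the other intervals differentiability at the tag compares the increment with the Riemann sum,
  exactly as for curves that are differentiable everywhere.
\<close>

lemma abs_continuous_on_has_integral:
  fixes f :: "real \<Rightarrow> 'a::banach"
  assumes "a \<le> b" and ac: "abs_continuous_on {a..b} f"
    and der: "AE t in lebesgue. t \<in> {a..b} \<longrightarrow> (f has_vector_derivative f' t) (at t within {a..b})"
  shows "(f' has_integral f b - f a) {a..b}"
proof (cases "a = b")
  case True
  then show ?thesis by auto
next
  case False
  with \<open>a \<le> b\<close> have "a < b" by simp
  obtain N where "N \<in> null_sets lebesgue"
    and "\<And>t. t \<in> space lebesgue - N \<Longrightarrow> t \<in> {a..b} \<longrightarrow> (f has_vector_derivative f' t) (at t within {a..b})"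
    using AE_E3[OF der] by blast
  then have N: "negligible N"
    and vecd: "\<And>t. t \<in> {a..b} \<Longrightarrow> t \<notin> N \<Longrightarrow> (f has_vector_derivative f' t) (at t within {a..b})"
    by (auto simp: negligible_iff_null_sets)
  define g where "g t = (if t \<in> N then 0 else f' t)" for t
  have "(g has_integral f b - f a) {a..b}"
    unfolding has_integral_factor_content_real
  proof (intro allI impI)
    fix e :: real
    assume "e > 0"
    then have e2: "e/2 > 0" "e/2 * (b - a) > 0" using \<open>a < b\<close> by auto
    have "\<forall>x. \<exists>d>0. x \<in> {a..b} - N \<longrightarrow>
           (\<forall>y\<in>{a..b}. norm (y-x) < d \<longrightarrow> norm (f y - f x - (y-x) *\<^sub>R f' x) \<le> e/2 * norm (y-x))"
      using vecd[unfolded has_vector_derivative_def has_derivative_within_alt] e2(1)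
      by (metis DiffD1 DiffD2 zero_less_one)
    then obtain d where d: "\<And>x. 0 < d x"
      "\<And>x y. \<lbrakk>x \<in> {a..b} - N; y \<in> {a..b}; norm (y-x) < d x\<rbrakk>
                          \<Longrightarrow> norm (f y - f x - (y-x) *\<^sub>R f' x) \<le> e/2 * norm (y-x)"
      by metis
    obtain \<delta> where "\<delta> > 0" and \<delta>: "\<And>\<D>. \<lbrakk>\<D> division_of \<Union>\<D>; \<Union>\<D> \<subseteq> {a..b}; (\<Sum>k\<in>\<D>. Sup k - Inf k) < \<delta>\<rbrakk>
        \<Longrightarrow> (\<Sum>k\<in>\<D>. norm (f (Sup k) - f (Inf k))) < e/2 * (b - a)"
      using ac e2(2) unfolding abs_continuous_on_def by meson
    obtain U where U: "open U" "N \<subseteq> U" "U \<in> lmeasurable" "measure lebesgue U < \<delta>"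
      using negligible_open_superset_small[OF N \<open>\<delta> > 0\<close>] by blast
    define G where "G x = (if x \<in> N then U else ball x (d x))" for x
    show "\<exists>d. gauge d \<and> (\<forall>p. p tagged_division_of {a..b} \<and> d fine p \<longrightarrow>
        norm ((\<Sum>(x,k)\<in>p. measure lborel k *\<^sub>R g x) - (f b - f a)) \<le> e * measure lborel {a..b})"
    proof (intro exI[of _ G] conjI allI impI; (elim conjE)?)
      show "gauge G"
        using U d(1) by (auto simp: gauge_def G_def)
    next
      fix p
      assume p: "p tagged_division_of {a..b}" and fine: "G fine p"
      have "finite p" using p by blast
      let ?D = "\<lambda>K. f (Sup K) - f (Inf K)"
      define q where "q = {(x,K) \<in> p. x \<in> N}"
      have "q \<subseteq> p" by (auto simp: q_def)
      have K: "\<exists>u v. u \<le> v \<and> K = {u..v} \<and> u \<in> {a..b} \<and> v \<in> {a..b} \<and> x \<in> K" if "(x, K) \<in> p" for x K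
      proof -
        obtain u v where "K = cbox u v" "x \<in> K" "K \<subseteq> {a..b}"
          using p \<open>(x, K) \<in> p\<close> by (meson tagged_division_ofD)
        then show ?thesis by (intro exI[of _ u] exI[of _ v]) auto
      qed
      have Kq: "\<exists>u v. u \<le> v \<and> K = {u..v} \<and> K \<subseteq> {a..b}" if "K \<in> snd ` q" for K
      proof -
        obtain x where "(x, K) \<in> p" using \<open>K \<in> snd ` q\<close> \<open>q \<subseteq> p\<close> by force
        then show ?thesis using K[of x K] by auto
      qed
      have q: "q tagged_division_of \<Union>(snd ` q)"
        using tagged_partial_division_of_Union_self tagged_partial_division_subset \<open>q \<subseteq> p\<close> p
          tagged_division_of_def by blast
      have qdiv: "snd ` q division_of \<Union>(snd ` q)"
        by (rule division_of_tagged_division[OF q])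
      \<comment> \<open>Intervals tagged in \<open>N\<close>: absolute continuity.\<close>
      have bad: "(\<Sum>(x,K)\<in>q. norm (?D K)) < e/2 * (b - a)"
      proof -
        have "(\<Sum>K\<in>snd ` q. Sup K - Inf K) = (\<Sum>K\<in>snd ` q. measure lebesgue K)"
          by (intro sum.cong refl) (use Kq in fastforce)
        also have "\<dots> = measure lebesgue (\<Union>(snd ` q))"
          by (rule content_division[OF qdiv])
        also have "\<dots> \<le> measure lebesgue U"
        proof (rule measure_mono_fmeasurable)
          show "\<Union>(snd ` q) \<subseteq> U"
          proof safe
            fix y x K assume "(x, K) \<in> q" "y \<in> snd (x, K)"
            then show "y \<in> U" using fineD[OF fine, of x K] by (auto simp: q_def G_def)
          qed
          show "\<Union>(snd ` q) \<in> sets lebesgue"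
            using lmeasurable_division[OF qdiv] by blast
        qed fact
        also have "\<dots> < \<delta>" by fact
        finally have "(\<Sum>K\<in>snd ` q. norm (?D K)) < e/2 * (b - a)"
          using Kq by (intro \<delta> qdiv) (blast, simp)
        moreover have "(\<Sum>(x,K)\<in>q. norm (?D K)) = (\<Sum>K\<in>snd ` q. norm (?D K))"
        proof -
          have ne: "K \<noteq> {}" if "(x, K) \<in> q" for x K
            using K[of x K] that \<open>q \<subseteq> p\<close> by blast
          \<comment> \<open>Different tags may share a degenerate interval; its increment vanishes. The case
            distinction handles \<open>{}\<close>, where \<open>Sup\<close> and \<open>Inf\<close> are arbitrary values.\<close>
          have "(\<Sum>(x,K)\<in>q. norm (?D K)) = (\<Sum>(x,K)\<in>q. if K = {} then 0 else norm (?D K))"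
            by (intro sum.cong refl) (auto dest: ne)
          also have "\<dots> = (\<Sum>K\<in>snd ` q. if K = {} then 0 else norm (?D K))"
          proof (rule sum.over_tagged_division_lemma[OF q])
            fix u v :: real
            assume "box u v = {}"
            then show "(if cbox u v = {} then 0 else norm (?D (cbox u v))) = 0"
              by (cases "u = v") (auto simp: box_eq_empty)
          qed
          also have "\<dots> = (\<Sum>K\<in>snd ` q. norm (?D K))"
            by (intro sum.cong refl) (auto dest: ne)
          finally show ?thesis .
        qed
        ultimately show ?thesis by simp
      qed
      \<comment> \<open>Intervals tagged outside \<open>N\<close>: differentiability at the tag.\<close>
      have good: "norm (measure lborel K *\<^sub>R f' x - ?D K) \<le> e/2 * (Sup K - Inf K)" if xK: "(x, K) \<in> p - q" for x K
      proof -
        obtain u v where uv: "u \<le> v" "K = {u..v}" "u \<in> {a..b}" "v \<in> {a..b}" "x \<in> K"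
          using K xK by blast
        have "x \<notin> N" using xK by (auto simp: q_def)
        then have "K \<subseteq> ball x (d x)" using fineD[OF fine, of x K] xK by (simp add: G_def)
        then have "u \<in> ball x (d x)" "v \<in> ball x (d x)"
          using uv by (meson atLeastAtMost_iff order_refl subsetD)+
        then have "norm (u - x) < d x" "norm (v - x) < d x"
          by (auto simp: dist_real_def)
        moreover have "x \<in> {a..b} - N" using uv \<open>x \<notin> N\<close> by auto
        ultimately have du: "norm (f u - f x - (u - x) *\<^sub>R f' x) \<le> e/2 * norm (u - x)"
          and dv: "norm (f v - f x - (v - x) *\<^sub>R f' x) \<le> e/2 * norm (v - x)"
          using d(2) uv by blast+
        have "norm ((v - u) *\<^sub>R f' x - (f v - f u)) = norm (f u - f x - (u - x) *\<^sub>R f' x - (f v - f x - (v - x) *\<^sub>R f' x))"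
          by (auto simp: algebra_simps)
        also have "\<dots> \<le> norm (f u - f x - (u - x) *\<^sub>R f' x) + norm (f v - f x - (v - x) *\<^sub>R f' x)"
          by (rule norm_triangle_ineq4)
        also have "\<dots> \<le> e/2 * norm (u - x) + e/2 * norm (v - x)"
          using du dv by linarith
        also have "\<dots> = e/2 * (v - u)"
          using uv by (auto simp: field_simps)
        finally show ?thesis using uv by simp
      qed
      have "(\<Sum>(x,k)\<in>p. measure lborel k *\<^sub>R g x) - (f b - f a) = (\<Sum>(x,K)\<in>p. measure lborel K *\<^sub>R g x - ?D K)"
        using additive_tagged_division_1[OF \<open>a \<le> b\<close> p, of f] by (simp add: split_def sum_subtractf)
      also have "norm \<dots> \<le> (\<Sum>(x,K)\<in>p. norm (measure lborel K *\<^sub>R g x - ?D K))"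
        unfolding split_def by (rule norm_sum)
      also have "\<dots> = (\<Sum>(x,K)\<in>p - q. norm (measure lborel K *\<^sub>R g x - ?D K)) + (\<Sum>(x,K)\<in>q. norm (measure lborel K *\<^sub>R g x - ?D K))"
        by (rule sum.subset_diff[OF \<open>q \<subseteq> p\<close> \<open>finite p\<close>])
      also have "(\<Sum>(x,K)\<in>q. norm (measure lborel K *\<^sub>R g x - ?D K)) = (\<Sum>(x,K)\<in>q. norm (?D K))"
        by (intro sum.cong refl) (auto simp: q_def g_def norm_minus_commute)
      also have "(\<Sum>(x,K)\<in>p - q. norm (measure lborel K *\<^sub>R g x - ?D K)) \<le> (\<Sum>(x,K)\<in>p - q. e/2 * (Sup K - Inf K))"
      proof (intro sum_mono, safe)
        fix x K assume xK: "(x, K) \<in> p" "(x, K) \<notin> q"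
        then have "g x = f' x" by (auto simp: q_def g_def)
        then show "norm (measure lborel K *\<^sub>R g x - ?D K) \<le> e/2 * (Sup K - Inf K)" using good xK by auto
      qed
      also have "\<dots> \<le> (\<Sum>(x,K)\<in>p. e/2 * (Sup K - Inf K))"
      proof (rule sum_mono2)
        show "0 \<le> (case y of (x, K) \<Rightarrow> e/2 * (Sup K - Inf K))" if y: "y \<in> p - (p - q)" for y
        proof -
          obtain x K where "y = (x, K)" "(x, K) \<in> p" using y by (cases y) auto
          then show ?thesis using K[of x K] \<open>e > 0\<close> by auto
        qed
      qed (use \<open>finite p\<close> in auto)
      also have "\<dots> = e/2 * (b - a)"
      proof -
        have "(\<Sum>(x,K)\<in>p. e/2 * (Sup K - Inf K)) = e/2 * (\<Sum>(x,K)\<in>p. Sup K - Inf K)"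
          by (simp only: sum_distrib_left split_def)
        then show ?thesis
          using additive_tagged_division_1[OF \<open>a \<le> b\<close> p, of "\<lambda>x. x"] by simp
      qed
      finally show "norm ((\<Sum>(x,k)\<in>p. measure lborel k *\<^sub>R g x) - (f b - f a)) \<le> e * measure lborel {a..b}"
        using bad \<open>a \<le> b\<close> by (simp add: field_simps)
    qed
  qed
  then show ?thesis
    by (rule has_integral_spike[OF N, rotated]) (simp add: g_def)
qed

text \<open>
  This turns a pointwise lower bound \<open>f\<close> for the speed \<open>h\<close> of a curve into one for its length. The
  gauge integrable \<open>f\<close> is Lebesgue measurable, so its positive part can be compared with \<open>h\<close>. That
  part may have infinite integral, as gauge integrability does not imply absolute integrability.
\<close>

lemma has_integral_le_nn_integral:
  fixes f h :: "'a::euclidean_space \<Rightarrow> real" and S :: "'a set"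
  assumes f: "(f has_integral I) S"
    and le: "AE t in lebesgue. t \<in> S \<longrightarrow> f t \<le> h t"
  shows "ennreal I \<le> (\<integral>\<^sup>+t\<in>S. ennreal (h t) \<partial>lebesgue)"
proof -
  define p where "p t = max 0 (f t * indicator S t)" for t
  have fm: "(\<lambda>t. f t * indicator S t) \<in> borel_measurable lebesgue"
    by (rule has_integral_implies_lebesgue_measurable_real[OF f])
  have p: "p \<in> borel_measurable lebesgue" "\<And>t. 0 \<le> p t"
    using fm unfolding p_def by auto
  have "ennreal I \<le> (\<integral>\<^sup>+t. ennreal (p t) \<partial>lebesgue)"
  proof (cases "(\<integral>\<^sup>+t. ennreal (p t) \<partial>lebesgue) < \<infinity>")
    case True
    then have int: "integrable lebesgue p"
      using p by (intro integrableI_nonneg) auto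
    have "((\<lambda>t. f t * indicator S t) has_integral I) UNIV"
      by (rule has_integral_eq[OF _ has_integral_restrict_UNIV[THEN iffD2, OF f]]) auto
    then have "I \<le> integral\<^sup>L lebesgue p"
      using has_integral_integral_lebesgue[OF int] by (rule has_integral_le) (simp add: p_def)
    then show ?thesis
      using nn_integral_eq_integral[OF int] p(2) by (simp add: ennreal_leI)
  next
    case False
    then show ?thesis by (simp add: less_top[symmetric])
  qed
  also have "\<dots> \<le> (\<integral>\<^sup>+t\<in>S. ennreal (h t) \<partial>lebesgue)"
  proof (rule nn_integral_mono_AE)
    show "AE t in lebesgue. ennreal (p t) \<le> ennreal (h t) * indicator S t"
      using le by eventually_elim (auto simp: p_def max_def ennreal_leI split: split_indicator)
  qed
  finally show ?thesis .
qed

lemma lipschitz_on_imp_abs_continuous_on: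
  assumes "L-lipschitz_on I f"
  shows "abs_continuous_on I f"
  unfolding abs_continuous_on_def
proof (intro allI impI)
  fix e :: real assume "e > 0"
  have "L \<ge> 0" using assms by (rule lipschitz_on_nonneg)
  have "(\<Sum>k\<in>d. norm (f (Sup k) - f (Inf k))) < e"
    if d: "d division_of \<Union>d" "\<Union>d \<subseteq> I" "(\<Sum>k\<in>d. Sup k - Inf k) < e / (L + 1)" for d
  proof -
    have "norm (f (Sup k) - f (Inf k)) \<le> L * (Sup k - Inf k)" if k: "k \<in> d" for k
    proof -
      have "k \<noteq> {}" "k \<subseteq> I" using division_ofD(2,3)[OF d(1) k] d(2) by auto
      moreover obtain u v where uv: "k = {u..v}" using division_ofD(4)[OF d(1) k] by auto
      ultimately have "u \<le> v" "u \<in> k" "v \<in> k" by simp_all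
      with \<open>k \<subseteq> I\<close> uv have "u \<le> v" "k = {u..v}" "u \<in> I" "v \<in> I" by blast+
      then show ?thesis
        using lipschitz_onD[OF assms, of v u] by (simp add: dist_norm)
    qed
    then have "(\<Sum>k\<in>d. norm (f (Sup k) - f (Inf k))) \<le> L * (\<Sum>k\<in>d. Sup k - Inf k)"
      by (simp add: sum_distrib_left sum_mono)
    also have "\<dots> \<le> L * (e / (L + 1))"
      using d(3) \<open>L \<ge> 0\<close> by (intro mult_left_mono) auto
    also have "\<dots> < e"
      using \<open>L \<ge> 0\<close> \<open>e > 0\<close> by (simp add: field_simps)
    finally show ?thesis .
  qed
  then show "\<exists>\<delta>>0. \<forall>d. d division_of \<Union>d \<and> \<Union>d \<subseteq> I \<and> (\<Sum>k\<in>d. Sup k - Inf k) < \<delta> \<longrightarrow>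
        (\<Sum>k\<in>d. norm (f (Sup k) - f (Inf k))) < e"
    using \<open>e > 0\<close> \<open>L \<ge> 0\<close> by (intro exI[of _ "e / (L + 1)"]) auto
qed

section \<open>Lower bound for the length\<close>

text \<open>
  Here \<open>(x, y)\<close> are the first coordinates of a point, \<open>(p, q)\<close> the frame coordinates of a velocity,
  \<open>m\<close> the value of \<open>\<alpha>\<close> and \<open>X\<close> an upper bound for \<open>\<bar>x\<bar>\<close> along the curve; \<open>x^2 y^b q\<close> is the third
  component of the velocity. The bound is linear in the velocity, so its integral along a curve
  is known as soon as the signs \<open>s1\<close> and \<open>s2\<close> are fixed on intervals. In the proof, \<open>k\<close> bounds the
  relative saving of the metric along \<open>y\<close>, and \<open>w\<close> is the part of it that is charged to the third
  component.
\<close>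

lemma calibration_bound:
  fixes x y p q X m s1 s2 :: real
  assumes X: "0 < X" "X \<le> 1" "\<bar>x\<bar> \<le> X" and y: "\<bar>y\<bar> \<le> 1" and b: "even b" "b \<le> 2 * a"
    and m: "0 \<le> m" "m \<le> 1" and s: "\<bar>s1\<bar> = 1" "\<bar>s2\<bar> = 1"
  shows "X * (s1 * p) + (1 - X\<^sup>2 / 2) * (s2 * q) - s2 * (x\<^sup>2 * y ^ b * q) / (2 * X\<^sup>2)
           \<le> sqrt (1 + X\<^sup>2) * sqrt (p * p + (1 - m * x * y ^ a) * (q * q))"
proof -
  define k w where "k = \<bar>x\<bar> * \<bar>y\<bar> ^ a" and "w = x\<^sup>2 * y ^ b / (2 * X\<^sup>2)"
  define r where "r = sqrt (1 - m * x * y ^ a)"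
  have yb: "y ^ b = \<bar>y\<bar> ^ b" "0 \<le> y ^ b" "y ^ b \<le> 1"
    using power_even_abs[OF b(1), of y] zero_le_even_power[OF b(1), of y] power_le_one[of "\<bar>y\<bar>" b] y by auto
  have k: "0 \<le> k" "k \<le> 1"
    using X y by (auto simp: k_def intro!: mult_le_one power_le_one)
  have "k\<^sup>2 = x\<^sup>2 * \<bar>y\<bar> ^ (2 * a)"
    by (simp add: k_def power_mult_distrib power_even_eq)
  also have "\<dots> \<le> x\<^sup>2 * \<bar>y\<bar> ^ b"
    using y b(2) by (intro mult_left_mono power_decreasing) auto
  finally have k2: "k\<^sup>2 \<le> x\<^sup>2 * y ^ b"
    by (simp add: yb(1))
  \<comment> \<open>Arithmetic-geometric mean inequality for \<open>X\<^sup>2\<close> and \<open>k\<^sup>2 / X\<^sup>2\<close>.\<close>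
  have "0 \<le> (X\<^sup>2 - k)\<^sup>2" by simp
  then have "2 * X\<^sup>2 * k \<le> X\<^sup>2 * X\<^sup>2 + x\<^sup>2 * y ^ b"
    using k2 by (simp add: power2_diff power2_eq_square algebra_simps)
  then have kw: "k \<le> X\<^sup>2 / 2 + w"
    using X(1) by (simp add: w_def field_simps power2_eq_square)
  have "x\<^sup>2 \<le> X\<^sup>2" using X by (simp add: abs_le_square_iff[symmetric])
  then have "x\<^sup>2 * y ^ b \<le> X\<^sup>2 * 1" using yb by (intro mult_mono) auto
  then have "w \<le> 1/2" using X(1) by (simp add: w_def field_simps)
  moreover have "X\<^sup>2 \<le> 1" using X by (simp add: power_le_one)
  ultimately have cw: "0 \<le> 1 - X\<^sup>2 / 2 - w" by simp
  have "\<bar>m * x * y ^ a\<bar> \<le> k"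
    using m by (simp add: k_def abs_mult power_abs mult.assoc mult_left_le_one_le)
  then have v: "m * x * y ^ a \<le> k" by linarith
  have "(1 - k)\<^sup>2 \<le> 1 - k" using k by (simp add: power2_eq_square mult_left_le_one_le)
  then have r: "1 - k \<le> r" unfolding r_def by (intro real_le_rsqrt) (use v in linarith)
  have "X * (s1 * p) + (1 - X\<^sup>2 / 2) * (s2 * q) - s2 * (x\<^sup>2 * y ^ b * q) / (2 * X\<^sup>2)
      = X * (s1 * p) + (1 - X\<^sup>2 / 2 - w) * (s2 * q)"
    by (simp add: w_def algebra_simps)
  also have "\<dots> \<le> X * \<bar>p\<bar> + (1 - X\<^sup>2 / 2 - w) * \<bar>q\<bar>"
    using X(1) cw s by (intro add_mono mult_left_mono) (auto simp: abs_mult intro: order_trans[OF abs_ge_self])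
  also have "\<dots> \<le> X * \<bar>p\<bar> + r * \<bar>q\<bar>"
    using kw r by (intro add_left_mono mult_right_mono) auto
  also have "\<dots> \<le> sqrt ((1 + X\<^sup>2) * (p * p + r\<^sup>2 * (q * q)))"
  proof (rule real_le_rsqrt)
    \<comment> \<open>Cauchy-Schwarz for \<open>(X, 1)\<close> and \<open>(\<bar>p\<bar>, r * \<bar>q\<bar>)\<close>.\<close>
    have "0 \<le> (\<bar>p\<bar> - X * (r * \<bar>q\<bar>))\<^sup>2" by simp
    then show "(X * \<bar>p\<bar> + r * \<bar>q\<bar>)\<^sup>2 \<le> (1 + X\<^sup>2) * (p * p + r\<^sup>2 * (q * q))"
      by (simp add: power2_eq_square algebra_simps)
  qed
  also have "r\<^sup>2 = 1 - m * x * y ^ a"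
    using v k by (simp add: r_def)
  finally show ?thesis by (simp add: real_sqrt_mult)
qed

text \<open>
  The pointwise bound is integrated with \<open>s2\<close> the sign of \<open>t - s\<close> and with \<open>s1\<close> changing its sign at
  a time \<open>\<tau>\<close> at which \<open>\<bar>x\<bar>\<close> attains its maximum \<open>X\<close>, so that each of \<open>[0, \<tau>]\<close> and \<open>[\<tau>, 1]\<close>
  contributes \<open>X\<close> to the integral of \<open>s1 * x'\<close>. If \<open>X = 0\<close>, the curve stays in the plane \<open>x = 0\<close>,
  where the metric is Euclidean.
\<close>

lemma curve_length_lower_bound:
  assumes hor: "horizontal M_space (sr_distr b) {0..1} \<eta>" and ends: "\<eta> 0 = \<gamma> s" "\<eta> 1 = \<gamma> t"
    and \<alpha>: "\<alpha> ` {-1<..<1} \<subseteq> {0..1}" and b: "even b" "b \<le> 2 * a"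
  shows "ennreal \<bar>s - t\<bar> \<le> curve_length (sr_metric a \<alpha>) \<eta>"
proof -
  define D where "D r = vector_derivative \<eta> (at r within {0..1})" for r
  define S where "S r = sqrt (sr_metric a \<alpha> (\<eta> r) (D r) (D r))" for r
  have M: "\<eta> r \<in> M_space" if "r \<in> {0..1}" for r
    using hor that by (auto simp: horizontal_def)
  have \<alpha>M: "0 \<le> \<alpha> (\<eta> r $ 2)" "\<alpha> (\<eta> r $ 2) \<le> 1" "\<bar>\<eta> r $ 2\<bar> \<le> 1" if "r \<in> {0..1}" for r
  proof -
    have "\<eta> r $ 2 \<in> {-1<..<1}" using M[OF that] by (auto simp: M_space_def)
    then have "\<alpha> (\<eta> r $ 2) \<in> {0..1}" "\<bar>\<eta> r $ 2\<bar> \<le> 1"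
      using \<alpha> by (blast, use \<open>\<eta> r $ 2 \<in> {-1<..<1}\<close> in auto)
    then show "0 \<le> \<alpha> (\<eta> r $ 2)" "\<alpha> (\<eta> r $ 2) \<le> 1" "\<bar>\<eta> r $ 2\<bar> \<le> 1"
      by auto
  qed
  have ac: "abs_continuous_on {0..1} \<eta>" using hor by (simp add: horizontal_def)
  have "AE r in lebesgue. r \<in> {0..1} \<longrightarrow>
      (\<exists>v. (\<eta> has_vector_derivative v) (at r within {0..1}) \<and> v \<in> sr_distr b (\<eta> r))"
    using hor by (simp add: horizontal_def)
  then have AE: "AE r in lebesgue. r \<in> {0..1} \<longrightarrow>
      (\<eta> has_vector_derivative D r) (at r within {0..1}) \<and> D r $ 3 = (\<eta> r $ 1)\<^sup>2 * (\<eta> r $ 2) ^ b * D r $ 2"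
  proof (eventually_elim, intro impI)
    fix r :: real
    assume "r \<in> {0..1} \<longrightarrow>
      (\<exists>v. (\<eta> has_vector_derivative v) (at r within {0..1}) \<and> v \<in> sr_distr b (\<eta> r))" and r: "r \<in> {0..1}"
    then obtain v where v: "(\<eta> has_vector_derivative v) (at r within {0..1})" "v \<in> sr_distr b (\<eta> r)"
      by blast
    have "D r = v"
      unfolding D_def using vector_derivative_within_closed_interval[OF _ r v(1)] by simp
    moreover have "v $ 3 = (\<eta> r $ 1)\<^sup>2 * (\<eta> r $ 2) ^ b * v $ 2"
      using arg_cong[OF sr_distr_frame_coords[OF v(2)], of "\<lambda>u. u $ 3"] by (simp add: X1_def X2_def)
    ultimately show "(\<eta> has_vector_derivative D r) (at r within {0..1}) \<and>
        D r $ 3 = (\<eta> r $ 1)\<^sup>2 * (\<eta> r $ 2) ^ b * D r $ 2"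
      using v(1) by simp
  qed
  have int: "(D has_integral \<eta> q - \<eta> p) {p..q}" if "0 \<le> p" "p \<le> q" "q \<le> 1" for p q
  proof (rule abs_continuous_on_has_integral)
    show "abs_continuous_on {p..q} \<eta>"
      using ac that by (auto intro: abs_continuous_on_subset)
    show "AE r in lebesgue. r \<in> {p..q} \<longrightarrow> (\<eta> has_vector_derivative D r) (at r within {p..q})"
      using AE by eventually_elim (use that in \<open>auto intro: has_vector_derivative_within_subset\<close>)
  qed fact
  have inti: "((\<lambda>r. D r $ i) has_integral \<eta> q $ i - \<eta> p $ i) {p..q}" if "0 \<le> p" "p \<le> q" "q \<le> 1" for p q i
    using has_integral_linear[OF int[OF that] bounded_linear_vec_nth[of i]] by (simp add: o_def)
  have "continuous_on {0..1} (\<lambda>r. \<eta> 0 + integral {0..r} D)"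
    using int[of 0 1] by (intro continuous_intros indefinite_integral_continuous_1) auto
  then have "continuous_on {0..1} \<eta>"
    by (rule continuous_on_eq) (simp add: integral_unique[OF int])
  then have "continuous_on {0..1} (\<lambda>r. \<bar>\<eta> r $ 1\<bar>)" by (intro continuous_intros)
  then obtain \<tau> where \<tau>: "\<tau> \<in> {0..1}" and max: "\<And>r. r \<in> {0..1} \<Longrightarrow> \<bar>\<eta> r $ 1\<bar> \<le> \<bar>\<eta> \<tau> $ 1\<bar>"
    using continuous_attains_sup[of "{0..1::real}" "\<lambda>r. \<bar>\<eta> r $ 1\<bar>"] by auto
  define X where "X = \<bar>\<eta> \<tau> $ 1\<bar>"
  define s2 :: real where "s2 = (if s \<le> t then 1 else - 1)"
  have s2: "\<bar>s2\<bar> = 1" "s2 * (t - s) = \<bar>s - t\<bar>" by (auto simp: s2_def)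
  have e: "\<eta> 0 $ 1 = 0" "\<eta> 1 $ 1 = 0" "\<eta> 0 $ 2 = s" "\<eta> 1 $ 2 = t" "\<eta> 0 $ 3 = 0" "\<eta> 1 $ 3 = 0"
    using ends by (simp_all add: \<gamma>_def)
  \<comment> \<open>The ends lie in the strip \<open>\<bar>y\<bar> < 1\<close>.\<close>
  have T: "\<bar>s - t\<bar> \<le> 2"
    using \<alpha>M(3)[of 0] \<alpha>M(3)[of 1] e by simp
  have len: "curve_length (sr_metric a \<alpha>) \<eta> = (\<integral>\<^sup>+r\<in>{0..1}. ennreal (S r) \<partial>lebesgue)"
    unfolding curve_length_def S_def D_def ..
  show ?thesis
  proof (cases "X = 0")
    case True
    have "((\<lambda>r. s2 * D r $ 2) has_integral s2 * (t - s)) {0..1}"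
      using has_integral_mult_right[OF inti[of 0 1 2], of s2] e by simp
    moreover have "s2 * D r $ 2 \<le> S r" if "r \<in> {0..1}" for r
    proof -
      have "\<eta> r $ 1 = 0" using max[OF that] True by (simp add: X_def)
      then have "S r = sqrt ((D r $ 1)\<^sup>2 + (D r $ 2)\<^sup>2)"
        by (simp add: S_def sr_metric_def power2_eq_square)
      also have "\<dots> \<ge> \<bar>D r $ 2\<bar>" by (simp add: real_le_rsqrt)
      finally show ?thesis by (auto simp: s2_def)
    qed
    ultimately have "ennreal (s2 * (t - s)) \<le> curve_length (sr_metric a \<alpha>) \<eta>"
      unfolding len by (intro has_integral_le_nn_integral AE_I2 impI)
    then show ?thesis by (simp only: s2)
  next
    case False
    then have "X > 0" by (simp add: X_def)
    have "X \<le> 1" using M[OF \<tau>] by (auto simp: X_def M_space_def)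
    define \<sigma> where "\<sigma> = sgn (\<eta> \<tau> $ 1)"
    define s1 where "s1 r = (if r \<le> \<tau> then \<sigma> else - \<sigma>)" for r
    have \<sigma>: "\<bar>\<sigma>\<bar> = 1" "\<sigma> * \<eta> \<tau> $ 1 = X"
      using \<open>X > 0\<close> by (auto simp: \<sigma>_def X_def abs_sgn sgn_if)
    define R where "R = sqrt (1 + X\<^sup>2)"
    have "R > 0" by (simp add: R_def add_pos_nonneg)
    have 1: "((\<lambda>r. s1 r * D r $ 1) has_integral X + X) {0..1}"
    proof (rule has_integral_combine)
      show "0 \<le> \<tau>" "\<tau> \<le> 1" using \<tau> by auto
      have "((\<lambda>r. \<sigma> * D r $ 1) has_integral X) {0..\<tau>}"
        using has_integral_mult_right[OF inti[of 0 \<tau> 1], of \<sigma>] \<tau> e \<sigma> by simp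
      then show "((\<lambda>r. s1 r * D r $ 1) has_integral X) {0..\<tau>}"
        by (rule has_integral_eq[rotated]) (simp add: s1_def)
      have "((\<lambda>r. - \<sigma> * D r $ 1) has_integral X) {\<tau>..1}"
        using has_integral_mult_right[OF inti[of \<tau> 1 1], of "- \<sigma>"] \<tau> e \<sigma> by simp
      then show "((\<lambda>r. s1 r * D r $ 1) has_integral X) {\<tau>..1}"
        by (rule has_integral_spike[of "{\<tau>}", rotated 2]) (auto simp: s1_def)
    qed
    define G where "G r = (X * (s1 r * D r $ 1) + (1 - X\<^sup>2 / 2) * (s2 * D r $ 2) - s2 * D r $ 3 / (2 * X\<^sup>2)) / R" for r
    have "((\<lambda>r. X * (s1 r * D r $ 1) + (1 - X\<^sup>2 / 2) * (s2 * D r $ 2) - s2 * D r $ 3 / (2 * X\<^sup>2))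
        has_integral X * (X + X) + (1 - X\<^sup>2 / 2) * (s2 * (\<eta> 1 $ 2 - \<eta> 0 $ 2)) - s2 * (\<eta> 1 $ 3 - \<eta> 0 $ 3) / (2 * X\<^sup>2)) {0..1}"
      by (intro has_integral_diff has_integral_add has_integral_mult_right has_integral_divide 1 inti) auto
    then have "(G has_integral (2 * X\<^sup>2 + (1 - X\<^sup>2 / 2) * \<bar>s - t\<bar>) / R) {0..1}"
      unfolding G_def using s2 e by (intro has_integral_divide) (simp add: power2_eq_square mult.left_commute)
    moreover have "AE r in lebesgue. r \<in> {0..1} \<longrightarrow> G r \<le> S r"
      using AE
    proof (eventually_elim, intro impI)
      fix r :: real
      assume r: "r \<in> {0..1}" and "r \<in> {0..1} \<longrightarrow> (\<eta> has_vector_derivative D r) (at r within {0..1}) \<and>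
          D r $ 3 = (\<eta> r $ 1)\<^sup>2 * (\<eta> r $ 2) ^ b * D r $ 2"
      then have D3: "D r $ 3 = (\<eta> r $ 1)\<^sup>2 * (\<eta> r $ 2) ^ b * D r $ 2" by blast
      have "G r * R \<le> R * S r"
        using calibration_bound[OF \<open>X > 0\<close> \<open>X \<le> 1\<close> max[OF r, folded X_def] \<alpha>M(3)[OF r] b \<alpha>M(1,2)[OF r], of "s1 r" s2 "D r $ 1" "D r $ 2"]
          s2 \<sigma> \<open>R > 0\<close>
        by (simp add: G_def S_def sr_metric_def R_def[symmetric] D3 s1_def)
      then show "G r \<le> S r" using \<open>R > 0\<close> by (simp add: mult.commute)
    qed
    ultimately have "ennreal ((2 * X\<^sup>2 + (1 - X\<^sup>2 / 2) * \<bar>s - t\<bar>) / R) \<le> curve_length (sr_metric a \<alpha>) \<eta>"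
      unfolding len by (rule has_integral_le_nn_integral)
    moreover have "\<bar>s - t\<bar> \<le> (2 * X\<^sup>2 + (1 - X\<^sup>2 / 2) * \<bar>s - t\<bar>) / R"
    proof -
      have "R \<le> 1 + X\<^sup>2 / 2"
        unfolding R_def by (rule real_le_lsqrt)
          (use zero_le_square[of "X * X"] in \<open>auto simp: power2_eq_square algebra_simps\<close>)
      then have "\<bar>s - t\<bar> * R \<le> \<bar>s - t\<bar> * (1 + X\<^sup>2 / 2)" by (rule mult_left_mono) simp
      moreover have "\<bar>s - t\<bar> * X\<^sup>2 \<le> 2 * X\<^sup>2" using T by (rule mult_right_mono) simp
      ultimately show ?thesis using \<open>R > 0\<close> by (simp add: field_simps)
    qed
    ultimately show ?thesis by (meson ennreal_leI order_trans)
  qed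
qed

section \<open>The segments of the curve\<close>

lemma \<gamma>_affine:
  "\<gamma> u - \<gamma> v = (u - v) *\<^sub>R \<gamma> 1" "norm (\<gamma> 1) = 1"
  by (simp_all add: \<gamma>_def vec_eq_iff forall_3 norm_vec_def L2_set_def sum_3)

lemma segment_horizontal_length:
  assumes "s \<in> {-1<..<1}" "t \<in> {-1<..<1}"
  shows "horizontal M_space (sr_distr b) {0..1} (\<lambda>r. \<gamma> (s + r * (t - s)))"
    and "curve_length (sr_metric a \<alpha>) (\<lambda>r. \<gamma> (s + r * (t - s))) = ennreal \<bar>s - t\<bar>"
proof -
  let ?\<eta> = "\<lambda>r. \<gamma> (s + r * (t - s))"
  have eq: "?\<eta> = (\<lambda>r. \<gamma> s + r *\<^sub>R (t - s) *\<^sub>R \<gamma> 1)"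
    using \<gamma>_affine(1)[of "s + _ * (t - s)" s] by (simp add: fun_eq_iff diff_eq_eq add.commute)
  have der: "(?\<eta> has_vector_derivative (t - s) *\<^sub>R \<gamma> 1) (at r within {0..1})" for r
    unfolding eq by (auto intro!: derivative_eq_intros)
  have M: "?\<eta> r \<in> M_space" if "r \<in> {0..1}" for r
  proof -
    have "s + r * (t - s) = (1 - r) *\<^sub>R s + r *\<^sub>R t" by (simp add: algebra_simps)
    also have "\<dots> \<in> {-1<..<1}"
      using assms that by (intro convexD[OF convex_real_interval(8)]) auto
    finally show ?thesis by (simp add: \<gamma>_def M_space_def)
  qed
  have "\<bar>t - s\<bar>-lipschitz_on {0..1} ?\<eta>"
    unfolding eq
    by (intro lipschitz_onI) (simp_all add: dist_norm \<gamma>_affine(2) abs_mult flip: scaleR_diff_left left_diff_distrib)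
  then have "abs_continuous_on {0..1} ?\<eta>"
    by (rule lipschitz_on_imp_abs_continuous_on)
  moreover have "(t - s) *\<^sub>R \<gamma> 1 \<in> sr_distr b (?\<eta> r)" for r
  proof -
    \<comment> \<open>On the plane \<open>x = 0\<close> the field \<open>X2\<close> is the constant second unit vector.\<close>
    have "\<gamma> 1 = X2 b (?\<eta> r)" by (simp add: \<gamma>_def X2_def)
    then show ?thesis by (simp add: sr_distr_def span_base span_scale)
  qed
  ultimately show "horizontal M_space (sr_distr b) {0..1} ?\<eta>"
    unfolding horizontal_def using M der by (auto simp: is_interval_cc intro!: AE_I2)
  have "curve_length (sr_metric a \<alpha>) ?\<eta> = (\<integral>\<^sup>+r\<in>{0..1::real}. ennreal \<bar>s - t\<bar> \<partial>lebesgue)"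
    unfolding curve_length_def
  proof (rule set_nn_integral_cong)
    fix r :: real
    assume r: "r \<in> space lebesgue \<inter> {0..1}"
    then have "vector_derivative ?\<eta> (at r within {0..1}) = (t - s) *\<^sub>R \<gamma> 1"
      using vector_derivative_within_closed_interval[OF _ _ der, of r] by simp
    then show "ennreal (sqrt (sr_metric a \<alpha> (?\<eta> r) (vector_derivative ?\<eta> (at r within {0..1}))
          (vector_derivative ?\<eta> (at r within {0..1})))) = ennreal \<bar>s - t\<bar>"
      by (simp add: sr_metric_def \<gamma>_def abs_minus_commute)
  qed auto
  also have "\<dots> = ennreal \<bar>s - t\<bar>"
    by (simp add: nn_integral_cmult_indicator)
  finally show "curve_length (sr_metric a \<alpha>) ?\<eta> = ennreal \<bar>s - t\<bar>" .
qed

section \<open>The curve is a geodesic\<close>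

text \<open>
  The distance formula holds between any two points \<open>\<gamma> s\<close>, \<open>\<gamma> t\<close> with \<open>\<bar>s\<bar>, \<bar>t\<bar> < 1\<close>, so every
  \<open>\<epsilon>\<close> in \<open>(0, 1)\<close> works; the value \<open>1/2\<close> is arbitrary.
\<close>

theorem theorem1p1:
  fixes a b :: nat
  assumes "a \<ge> 1" and "b \<ge> 1" and "even b" and "b \<le> 2 * a"
  shows "\<exists>\<epsilon>::real. 0 < \<epsilon> \<and> \<epsilon> < 1 \<and>
           (\<forall>\<alpha>::real \<Rightarrow> real. smooth_on {-1<..<1} \<alpha> \<and> \<alpha> ` {-1<..<1} \<subseteq> {0..1} \<longrightarrow>
              geodesic_on M_space (sr_distr b) (sr_metric a \<alpha>) {-\<epsilon>..\<epsilon>} \<gamma>)"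
proof (intro exI[of _ "1/2 :: real"] conjI allI impI)
  fix \<alpha> :: "real \<Rightarrow> real"
  assume \<alpha>: "smooth_on {-1<..<1} \<alpha> \<and> \<alpha> ` {-1<..<1} \<subseteq> {0..1}"
  have "sr_dist M_space (sr_distr b) (sr_metric a \<alpha>) (\<gamma> s) (\<gamma> t) = ennreal \<bar>s - t\<bar>"
    if "s \<in> {-1<..<1}" "t \<in> {-1<..<1}" for s t
    unfolding sr_dist_def
  proof (rule antisym)
    show "Inf {curve_length (sr_metric a \<alpha>) \<eta> |\<eta>.
        horizontal M_space (sr_distr b) {0..1} \<eta> \<and> \<eta> 0 = \<gamma> s \<and> \<eta> 1 = \<gamma> t} \<le> ennreal \<bar>s - t\<bar>"
      using segment_horizontal_length(1)[OF that]
      by (intro Inf_lower CollectI exI[of _ "\<lambda>r. \<gamma> (s + r * (t - s))"])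
        (simp add: segment_horizontal_length(2)[OF that])
    show "ennreal \<bar>s - t\<bar> \<le> Inf {curve_length (sr_metric a \<alpha>) \<eta> |\<eta>.
        horizontal M_space (sr_distr b) {0..1} \<eta> \<and> \<eta> 0 = \<gamma> s \<and> \<eta> 1 = \<gamma> t}"
      using curve_length_lower_bound assms(3,4) \<alpha> by (intro Inf_greatest) blast
  qed
  moreover have "\<gamma> ` {- (1/2)..1/2} \<subseteq> M_space" by (auto simp: \<gamma>_def M_space_def)
  ultimately show "geodesic_on M_space (sr_distr b) (sr_metric a \<alpha>) {- (1/2)..1/2} \<gamma>"
    by (auto simp: geodesic_on_def is_interval_cc)
qed auto

end
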